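(* Let $b,c,\nu,\rho\in\mathbb{C}$ with $\operatorname{Re}(c)>0$, $\operatorname{Re}(\nu)>-1$, $\operatorname{Re}(\rho)>0$, and let $z\in\mathbb{C}\setminus(-\infty,0]$. Then $$G_\nu^{(b,c)}(z;\rho)=\frac{(z/2)^\nu}{[\Gamma(\nu+1)]^2\,\Gamma(c)}\int_0^\infty t^{c+\nu-1}e^{-t-\frac{\rho}{t}}\;{}_0F_3\Big(-;\nu+1,\tfrac{\nu+1}{2},\tfrac{\nu+2}{2};\tfrac{-bz^2t^2}{16}\Big)\,dt .$$
   Context: For $\rho\in\mathbb{C}$ with $\operatorname{Re}(\rho)>0$ and $x\in\mathbb{C}$ put $\Gamma_\rho(x)=\int_0^\infty t^{x-1}e^{-t-\rho/t}\,dt$. The generalized Pochhammer symbol is $(\lambda;\rho)_\nu:=\Gamma_\rho(\lambda+\nu)/\Gamma(\lambda)$. The unified four parameter Bessel function is $$G_\nu^{(b,c)}(z;\rho):=\sum_{k=0}^\infty \frac{(-b)^k (c;\rho)_{2k+\nu}}{\Gamma(\nu+k+1)\,\Gamma(\nu+2k+1)}\,\frac{(z/2)^{2k+\nu}}{k!}.$$ Complex powers are principal. Also ${}_0F_3(-;a_1,a_2,a_3;x)=\sum_{k=0}^\infty \frac{1}{(a_1)_k(a_2)_k(a_3)_k}\frac{x^k}{k!}$ with $(a)_k=\Gamma(a+k)/\Gamma(a)$. *)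

theory Defs
  imports "HOL-Analysis.Analysis"
begin

text \<open>
  The integrals below are Lebesgue integrals over the open half-line, and complex powers are
  principal, via \<^const>\<open>powr\<close>.  As usual, the integral of a non-integrable function and the
  sum of a divergent series are unspecified or default values.
\<close>

text \<open>Meaningful for \<open>Re \<rho> > 0\<close>, where the integral converges for every complex \<open>x\<close>.\<close>

definition ext_Gamma :: "complex \<Rightarrow> complex \<Rightarrow> complex" where
  "ext_Gamma \<rho> x =
     (LBINT t:{0<..}. of_real t powr (x - 1) * exp (- of_real t - \<rho> / of_real t))"

definition gen_pochhammer :: "complex \<Rightarrow> complex \<Rightarrow> complex \<Rightarrow> complex" where
  "gen_pochhammer l \<rho> \<nu> = ext_Gamma \<rho> (l + \<nu>) / Gamma l"

definition unified_Bessel_term ::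
    "complex \<Rightarrow> complex \<Rightarrow> complex \<Rightarrow> complex \<Rightarrow> complex \<Rightarrow> nat \<Rightarrow> complex" where
  "unified_Bessel_term b c \<nu> \<rho> z k =
     (- b) ^ k * gen_pochhammer c \<rho> (2 * of_nat k + \<nu>)
       / (Gamma (\<nu> + of_nat k + 1) * Gamma (\<nu> + 2 * of_nat k + 1))
     * ((z / 2) powr (2 * of_nat k + \<nu>) / fact k)"

definition unified_Bessel ::
    "complex \<Rightarrow> complex \<Rightarrow> complex \<Rightarrow> complex \<Rightarrow> complex \<Rightarrow> complex" where
  "unified_Bessel b c \<nu> \<rho> z = (\<Sum>k. unified_Bessel_term b c \<nu> \<rho> z k)"

text \<open>
  The library's \<^const>\<open>pochhammer\<close> is \<open>Gamma (a + k) / Gamma a\<close> whenever \<open>a\<close> is not a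
  nonpositive integer (\<open>pochhammer_Gamma\<close>).
\<close>

definition hyp_0F3 :: "complex \<Rightarrow> complex \<Rightarrow> complex \<Rightarrow> complex \<Rightarrow> complex" where
  "hyp_0F3 a1 a2 a3 x =
     (\<Sum>k. 1 / (pochhammer a1 k * pochhammer a2 k * pochhammer a3 k) * (x ^ k / fact k))"

end

theory Submission
  imports Defs
begin

text \<open>
  Replacing the extended Gamma function in each term of the Bessel series by its defining integral
  turns the series into a sum of integrals of \<open>t ^ (2 * k)\<close> against one fixed kernel.  The factors
  \<open>Gamma (\<nu> + k + 1)\<close> and \<open>Gamma (\<nu> + 2 * k + 1)\<close> are \<open>Gamma (\<nu> + 1)\<close> times the Pochhammer symbols
  \<open>(\<nu> + 1)\<^sub>k\<close> and \<open>(\<nu> + 1)\<^sub>2\<^sub>k\<close>, and the duplication formula splits the latter as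
  \<open>4 ^ k * ((\<nu> + 1) / 2)\<^sub>k * ((\<nu> + 2) / 2)\<^sub>k\<close>.  Hence summing under the integral sign gives the
  hypergeometric function (\<open>unified_Bessel_term_eq\<close>, \<open>hyp_0F3_eq_Bessel_coeff_series\<close>).

  The analytic content is the exchange of sum and integral, which is dominated convergence for
  series.  Half of the decay \<open>exp (- t)\<close> of the kernel is spent on the power, as
  \<open>t ^ n * exp (- t) \<le> n! * 2 ^ n * exp (- t / 2)\<close>.  What remains is an integrable function of \<open>t\<close>
  that depends on neither \<open>n\<close> nor the coefficients, so a series with coefficients
  \<open>A k\<close> and exponents \<open>e k\<close> may be integrated termwise as soon as
  \<open>\<Sum>k. norm (A k) * (e k)! * 2 ^ e k\<close> converges
  (\<open>ext_Gamma_kernel_series_integrable\<close>, \<open>ext_Gamma_kernel_series_sums\<close>).  Here \<open>(2 * k)!\<close> is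
  absorbed by \<open>(\<nu> + 1)\<^sub>2\<^sub>k\<close>, because a Pochhammer symbol with base in the right half-plane is at
  least \<open>n!\<close> up to an exponential factor (\<open>fact_le_norm_pochhammer\<close>), and the exponential series
  dominates what is left (\<open>summable_Bessel_coeff\<close>).
\<close>

section \<open>The kernel of the extended Gamma function\<close>

definition ext_Gamma_kernel :: "complex \<Rightarrow> complex \<Rightarrow> real \<Rightarrow> complex" where
  "ext_Gamma_kernel \<rho> x t = of_real t powr (x - 1) * exp (- of_real t - \<rho> / of_real t)"

lemma power_le_fact_mult_exp:
  fixes x :: real
  assumes "x \<ge> 0"
  shows "x ^ n \<le> fact n * exp x"
proof -
  have "(\<Sum>k\<in>{n}. x ^ k /\<^sub>R fact k) \<le> (\<Sum>k. x ^ k /\<^sub>R fact k)"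
    using assms by (intro sum_le_suminf summable_exp_generic) auto
  then show ?thesis
    by (simp add: exp_def field_simps)
qed

text \<open>
  For small \<open>t\<close> the factor \<open>exp (- r / t)\<close> beats every negative power of \<open>t\<close>: it is at most a
  constant times \<open>t ^ n\<close>, and a large \<open>n\<close> lifts the exponent into the range where Euler's Gamma
  integral converges.
\<close>

lemma powr_exp_two_sided_integrable:
  fixes s a r :: real
  assumes "a > 0" "r > 0"
  shows "set_integrable lborel {0<..} (\<lambda>t. t powr s * exp (- (a * t) - r / t))"
proof -
  obtain n :: nat where n: "- s - 1 < real n"
    using reals_Archimedean2 by blast
  define z where "z = complex_of_real (s + real n + 1)"
  have "(\<lambda>t. complex_of_real t powr (z - 1) / of_real (exp (a * t))) absolutely_integrable_on {0<..}"
    by (rule absolutely_integrable_Gamma_integral) (use n assms in \<open>auto simp: z_def\<close>)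
  moreover have "set_borel_measurable borel {0<..}
      (\<lambda>t. complex_of_real t powr (z - 1) / of_real (exp (a * t)))"
    unfolding set_borel_measurable_def
    by (rule borel_measurable_continuous_on_indicator) (auto intro!: continuous_intros)
  ultimately have "set_integrable lborel {0<..}
      (\<lambda>t. complex_of_real t powr (z - 1) / of_real (exp (a * t)))"
    unfolding set_integrable_def set_borel_measurable_def
    by (subst (asm) integrable_completion) auto
  then have int: "set_integrable lborel {0<..}
      (\<lambda>t. of_real (fact n / r ^ n) * (complex_of_real t powr (z - 1) / of_real (exp (a * t))))"
    by (rule set_integrable_mult_right)
  show ?thesis
  proof (rule set_integrable_bound[OF int])
    have "set_borel_measurable borel {0<..} (\<lambda>t. t powr s * exp (- (a * t) - r / t))"
      unfolding set_borel_measurable_def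
      by (rule borel_measurable_continuous_on_indicator) (auto intro!: continuous_intros)
    then show "set_borel_measurable lborel {0<..} (\<lambda>t. t powr s * exp (- (a * t) - r / t))"
      by (simp add: set_borel_measurable_def)
    have "norm (t powr s * exp (- (a * t) - r / t)) \<le>
        norm (of_real (fact n / r ^ n) * (complex_of_real t powr (z - 1) / of_real (exp (a * t))))"
      if t: "t > 0" for t :: real
    proof -
      have "(r / t) ^ n \<le> fact n * exp (r / t)"
        using t assms by (intro power_le_fact_mult_exp) auto
      then have "exp (- (r / t)) \<le> fact n / r ^ n * t ^ n"
        using t assms by (simp add: exp_minus field_simps power_divide)
      then have "t powr s * exp (- (a * t)) * exp (- (r / t))
          \<le> t powr s * exp (- (a * t)) * (fact n / r ^ n * t ^ n)"
        by (intro mult_left_mono) auto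
      moreover have "norm (of_real (fact n / r ^ n) *
          (complex_of_real t powr (z - 1) / of_real (exp (a * t)))) =
          fact n / r ^ n * (t powr (s + real n) / exp (a * t))"
        using t assms by (simp add: z_def norm_mult norm_divide norm_power norm_powr_real_powr)
      moreover have "\<dots> = t powr s * exp (- (a * t)) * (fact n / r ^ n * t ^ n)"
        using t by (simp add: powr_add powr_realpow exp_minus divide_inverse)
      moreover have "norm (t powr s * exp (- (a * t) - r / t)) =
          t powr s * exp (- (a * t)) * exp (- (r / t))"
        by (simp add: abs_mult mult.assoc flip: exp_add)
      ultimately show ?thesis
        by linarith
    qed
    then show "AE t in lborel. t \<in> {0<..} \<longrightarrow> norm (t powr s * exp (- (a * t) - r / t)) \<le>
        norm (of_real (fact n / r ^ n) * (complex_of_real t powr (z - 1) / of_real (exp (a * t))))"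
      by auto
  qed
qed

text \<open>
  Half of the decay \<open>exp (- t)\<close> pays for the power \<open>t ^ n\<close>, so that the majorant depends on \<open>n\<close>
  only through a constant factor.
\<close>

lemma norm_ext_Gamma_kernel_power_le:
  assumes "t > 0"
  shows "norm (ext_Gamma_kernel \<rho> x t * of_real t ^ n) \<le>
    fact n * 2 ^ n * (t powr (Re x - 1) * exp (- (1 / 2 * t) - Re \<rho> / t))"
proof -
  have "(t / 2) ^ n \<le> fact n * exp (t / 2)"
    using assms by (intro power_le_fact_mult_exp) auto
  then have "t ^ n \<le> fact n * 2 ^ n * exp (t / 2)"
    by (simp add: power_divide field_simps)
  then have "t powr (Re x - 1) * exp (- t - Re \<rho> / t) * t ^ n
      \<le> t powr (Re x - 1) * exp (- t - Re \<rho> / t) * (fact n * 2 ^ n * exp (t / 2))"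
    by (intro mult_left_mono) auto
  also have "\<dots> = fact n * 2 ^ n * (t powr (Re x - 1) * (exp (- t - Re \<rho> / t) * exp (t / 2)))"
    by (simp add: algebra_simps)
  also have "exp (- t - Re \<rho> / t) * exp (t / 2) = exp (- (1 / 2 * t) - Re \<rho> / t)"
    by (simp flip: exp_add add: field_simps)
  finally show ?thesis
    using assms
    by (simp add: ext_Gamma_kernel_def norm_mult norm_power norm_powr_real_powr)
qed

lemma ext_Gamma_kernel_add_nat:
  assumes "t > 0"
  shows "ext_Gamma_kernel \<rho> (x + of_nat n) t = ext_Gamma_kernel \<rho> x t * of_real t ^ n"
proof -
  have "of_real t powr (x + of_nat n - 1) = of_real t powr ((x - 1) + of_nat n)"
    by (simp add: algebra_simps)
  also have "\<dots> = of_real t powr (x - 1) * of_real t ^ n"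
    using assms by (simp only: powr_add powr_nat) auto
  finally show ?thesis
    by (simp add: ext_Gamma_kernel_def)
qed

lemma ext_Gamma_kernel_power_integrable:
  assumes "Re \<rho> > 0"
  shows "set_integrable lborel {0<..} (\<lambda>t. ext_Gamma_kernel \<rho> x t * of_real t ^ n)"
proof (rule set_integrable_bound)
  show "set_integrable lborel {0<..}
      (\<lambda>t. fact n * 2 ^ n * (t powr (Re x - 1) * exp (- (1 / 2 * t) - Re \<rho> / t)))"
    using assms by (intro set_integrable_mult_right powr_exp_two_sided_integrable) auto
  have "set_borel_measurable borel {0<..} (\<lambda>t. ext_Gamma_kernel \<rho> x t * of_real t ^ n)"
    unfolding set_borel_measurable_def ext_Gamma_kernel_def
    by (rule borel_measurable_continuous_on_indicator) (auto intro!: continuous_intros)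
  then show "set_borel_measurable lborel {0<..} (\<lambda>t. ext_Gamma_kernel \<rho> x t * of_real t ^ n)"
    by (simp add: set_borel_measurable_def)
  show "AE t in lborel. t \<in> {0<..} \<longrightarrow> norm (ext_Gamma_kernel \<rho> x t * of_real t ^ n) \<le>
      norm (fact n * 2 ^ n * (t powr (Re x - 1) * exp (- (1 / 2 * t) - Re \<rho> / t)))"
    using norm_ext_Gamma_kernel_power_le by (auto simp: abs_mult)
qed

section \<open>Termwise integration\<close>

text \<open>
  Both conclusions are instances of dominated convergence for series: the \<open>k\<close>-th term is bounded by
  a summable constant times a fixed integrable function, which gives pointwise absolute convergence
  as well as summability of the \<open>L\<^sup>1\<close> norms.
\<close>

lemma
  fixes A :: "nat \<Rightarrow> complex" and e :: "nat \<Rightarrow> nat"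
  assumes rho: "Re \<rho> > 0" and A: "summable (\<lambda>k. norm (A k) * (fact (e k) * 2 ^ e k))"
  shows ext_Gamma_kernel_series_integrable:
      "set_integrable lborel {0<..} (\<lambda>t. ext_Gamma_kernel \<rho> x t * (\<Sum>k. A k * of_real t ^ e k))"
    and ext_Gamma_kernel_series_sums:
      "(\<lambda>k. A k * ext_Gamma \<rho> (x + of_nat (e k))) sums
         (LBINT t:{0<..}. ext_Gamma_kernel \<rho> x t * (\<Sum>k. A k * of_real t ^ e k))"
proof -
  define J where "J t = t powr (Re x - 1) * exp (- (1 / 2 * t) - Re \<rho> / t)" for t :: real
  define B where "B k = norm (A k) * (fact (e k) * 2 ^ e k)" for k
  define f where "f k t = indicator {0<..} t *\<^sub>R
    (A k * (ext_Gamma_kernel \<rho> x t * of_real t ^ e k))" for k t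
  have sumB: "summable B"
    using A by (simp add: B_def[abs_def])
  have J: "set_integrable lborel {0<..} J"
    unfolding J_def using rho by (intro powr_exp_two_sided_integrable) auto
  have f: "integrable lborel (f k)" for k
    using set_integrable_mult_right[OF ext_Gamma_kernel_power_integrable[OF rho], of "A k" x "e k"]
    by (simp add: f_def[abs_def] set_integrable_def)
  have bound: "norm (f k t) \<le> B k * (indicator {0<..} t *\<^sub>R J t)" for k t
    using mult_left_mono[OF norm_ext_Gamma_kernel_power_le[of t \<rho> x "e k"], of "norm (A k)"]
    by (auto simp: f_def B_def J_def norm_mult indicator_def mult_ac)
  have norm_sum: "summable (\<lambda>k. norm (f k t))" for t
    using bound by (intro summable_comparison_test'[OF summable_mult2[OF sumB]]) auto
  have int_sum: "summable (\<lambda>k. \<integral>t. norm (f k t) \<partial>lborel)"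
  proof (rule summable_comparison_test'[OF summable_mult2[OF sumB]])
    show "norm (\<integral>t. norm (f k t) \<partial>lborel) \<le> B k * (LBINT t:{0<..}. J t)" for k
    proof -
      have "(\<integral>t. norm (f k t) \<partial>lborel) \<le> (\<integral>t. B k * (indicator {0<..} t *\<^sub>R J t) \<partial>lborel)"
        using J f bound by (intro integral_mono) (auto simp: set_integrable_def)
      then show ?thesis
        by (simp add: set_lebesgue_integral_def)
    qed
  qed
  have suminf_f: "(\<Sum>k. f k t) =
      indicator {0<..} t *\<^sub>R (ext_Gamma_kernel \<rho> x t * (\<Sum>k. A k * of_real t ^ e k))" for t
  proof (cases "t > 0")
    case True
    \<comment> \<open>The kernel can be cancelled, so the pointwise convergence passes to the bare power series.\<close>
    then have nz: "ext_Gamma_kernel \<rho> x t \<noteq> 0"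
      by (simp add: ext_Gamma_kernel_def)
    have eq: "f k t = ext_Gamma_kernel \<rho> x t * (A k * of_real t ^ e k)" for k
      using True by (simp add: f_def)
    have "summable (\<lambda>k. f k t)"
      using norm_sum by (rule summable_norm_cancel)
    then have "summable (\<lambda>k. A k * of_real t ^ e k)"
      using nz by (simp add: eq summable_cmult_iff)
    then show ?thesis
      using True by (simp add: eq suminf_mult)
  qed (simp add: f_def)
  have int_f: "(\<integral>t. f k t \<partial>lborel) = A k * ext_Gamma \<rho> (x + of_nat (e k))" for k
  proof -
    have "(\<integral>t. f k t \<partial>lborel) =
        (LBINT t:{0<..}. A k * (ext_Gamma_kernel \<rho> x t * of_real t ^ e k))"
      by (simp only: f_def set_lebesgue_integral_def)
    also have "\<dots> = A k * (LBINT t:{0<..}. ext_Gamma_kernel \<rho> x t * of_real t ^ e k)"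
      by simp
    also have "(LBINT t:{0<..}. ext_Gamma_kernel \<rho> x t * of_real t ^ e k) =
        (LBINT t:{0<..}. ext_Gamma_kernel \<rho> (x + of_nat (e k)) t)"
      by (rule set_lebesgue_integral_cong) (auto simp: ext_Gamma_kernel_add_nat)
    finally show ?thesis
      by (simp add: ext_Gamma_def ext_Gamma_kernel_def)
  qed
  show "set_integrable lborel {0<..}
      (\<lambda>t. ext_Gamma_kernel \<rho> x t * (\<Sum>k. A k * of_real t ^ e k))"
    using integrable_suminf[of lborel f] f norm_sum int_sum
    by (simp add: suminf_f set_integrable_def)
  show "(\<lambda>k. A k * ext_Gamma \<rho> (x + of_nat (e k))) sums
      (LBINT t:{0<..}. ext_Gamma_kernel \<rho> x t * (\<Sum>k. A k * of_real t ^ e k))"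
    using sums_integral[of lborel f] f norm_sum int_sum
    by (simp add: suminf_f int_f set_lebesgue_integral_def)
qed

section \<open>The coefficients of the Bessel series\<close>

text \<open>
  Each factor \<open>a + j\<close> with \<open>j \<ge> 1\<close> has norm at least \<open>j\<close>, while the factor with \<open>j = 0\<close> contributes
  \<open>Re a\<close>.  This yields \<open>(n - 1)! * Re a\<close>, and the missing factor \<open>n\<close> is at most \<open>2 ^ n\<close>.
\<close>

lemma fact_le_norm_pochhammer:
  fixes a :: complex
  assumes "Re a > 0"
  shows "fact n \<le> max 1 (1 / Re a) * 2 ^ n * norm (pochhammer a n)"
proof (cases n)
  case (Suc m)
  have "fact m * Re a \<le> norm (pochhammer a (Suc m))" for m
  proof (induction m)
    case 0
    show ?case
      using complex_Re_le_cmod[of a] by simp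
  next
    case (Suc m)
    have "real (Suc m) \<le> Re (a + of_nat (Suc m))"
      using assms by simp
    also have "\<dots> \<le> norm (a + of_nat (Suc m))"
      by (rule complex_Re_le_cmod)
    finally have "(fact m * Re a) * real (Suc m)
        \<le> norm (pochhammer a (Suc m)) * norm (a + of_nat (Suc m))"
      using assms by (intro mult_mono Suc.IH) auto
    then show ?case
      by (simp only: pochhammer_Suc[of a "Suc m"] norm_mult fact_Suc mult_ac of_nat_mult)
  qed
  then have m: "fact m * Re a \<le> norm (pochhammer a n)"
    using Suc by simp
  have "real n \<le> 2 ^ n"
    using of_nat_less_two_power[of n, where 'a = real] by linarith
  then have "fact n \<le> 2 ^ n * (fact m :: real)"
    using Suc by (simp only: fact_Suc) (intro mult_right_mono, auto)
  also have "\<dots> \<le> 2 ^ n * (1 / Re a * norm (pochhammer a n))"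
    using m assms by (intro mult_left_mono) (auto simp: field_simps)
  also have "\<dots> \<le> 2 ^ n * (max 1 (1 / Re a) * norm (pochhammer a n))"
    by (intro mult_left_mono mult_right_mono) auto
  finally show ?thesis
    by (simp add: mult_ac)
qed simp

text \<open>
  These are the coefficients of \<open>t ^ (2 * k)\<close> in the hypergeometric integrand when
  \<open>u = - b * (z / 2)\<^sup>2\<close>.
\<close>

definition Bessel_coeff :: "complex \<Rightarrow> complex \<Rightarrow> nat \<Rightarrow> complex" where
  "Bessel_coeff \<nu> u k =
     u ^ k / (pochhammer (\<nu> + 1) k * pochhammer (\<nu> + 1) (2 * k) * fact k)"

text \<open>
  One Pochhammer symbol cancels \<open>(2 * k)!\<close> up to \<open>4 ^ k\<close>.  Of the other only an exponential lower
  bound is used, since the \<open>k!\<close> in the denominator already forces convergence.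
\<close>

lemma summable_Bessel_coeff:
  assumes "Re \<nu> > -1"
  shows "summable (\<lambda>k. norm (Bessel_coeff \<nu> u k) * (fact (2 * k) * 2 ^ (2 * k)))"
proof -
  define D where "D = max 1 (1 / Re (\<nu> + 1))"
  have D: "D \<ge> 1"
    by (simp add: D_def)
  have a: "Re (\<nu> + 1) > 0"
    using assms by simp
  have nz: "norm (pochhammer (\<nu> + 1) n) > 0" for n
  proof -
    have "0 < (fact n :: real)"
      by simp
    also have "\<dots> \<le> D * 2 ^ n * norm (pochhammer (\<nu> + 1) n)"
      unfolding D_def by (rule fact_le_norm_pochhammer[OF a])
    finally show ?thesis
      using zero_less_mult_pos2 D by (auto simp: zero_less_mult_iff)
  qed
  have poch: "fact n / norm (pochhammer (\<nu> + 1) n) \<le> D * 2 ^ n" for n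
    using fact_le_norm_pochhammer[OF a, of n] nz[of n] by (simp add: D_def field_simps)
  have poch': "1 / norm (pochhammer (\<nu> + 1) n) \<le> D * 2 ^ n" for n
  proof -
    have "1 / norm (pochhammer (\<nu> + 1) n) \<le> fact n / norm (pochhammer (\<nu> + 1) n)"
      by (intro divide_right_mono) auto
    then show ?thesis
      using poch[of n] by linarith
  qed
  have "summable (\<lambda>k. D\<^sup>2 * ((32 * norm u) ^ k / fact k))"
    using summable_exp[of "32 * norm u"] by (intro summable_mult) (simp add: divide_inverse mult_ac)
  then show ?thesis
  proof (rule summable_comparison_test')
    fix k :: nat
    \<comment> \<open>The base \<open>32\<close> collects \<open>4\<close> from the power \<open>2 ^ (2 * k)\<close>, and \<open>2\<close> and \<open>4\<close> from the two
      Pochhammer bounds.\<close>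
    have "norm (Bessel_coeff \<nu> u k) * (fact (2 * k) * 2 ^ (2 * k)) =
        norm u ^ k * 2 ^ (2 * k) / fact k *
        (1 / norm (pochhammer (\<nu> + 1) k) *
         (fact (2 * k) / norm (pochhammer (\<nu> + 1) (2 * k))))"
      by (simp add: Bessel_coeff_def norm_divide norm_mult norm_power) (simp only: mult_ac)
    also have "\<dots> \<le> norm u ^ k * 2 ^ (2 * k) / fact k * ((D * 2 ^ k) * (D * 2 ^ (2 * k)))"
      using D by (intro mult_left_mono mult_mono poch poch') auto
    also have "\<dots> = D\<^sup>2 * ((2 ^ (2 * k) * 2 ^ k * 2 ^ (2 * k) * norm u ^ k) / fact k)"
      by (simp add: power2_eq_square)
    also have "2 ^ (2 * k) * 2 ^ k * 2 ^ (2 * k) * norm u ^ k = (2\<^sup>2 * 2 * 2\<^sup>2 * norm u) ^ k"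
      by (simp only: power_mult power_mult_distrib)
    also have "2\<^sup>2 * 2 * 2\<^sup>2 * norm u = 32 * norm u"
      by simp
    finally show "norm (norm (Bessel_coeff \<nu> u k) * (fact (2 * k) * 2 ^ (2 * k)))
        \<le> D\<^sup>2 * ((32 * norm u) ^ k / fact k)"
      by simp
  qed
qed

section \<open>Comparison of the two series\<close>

text \<open>
  The duplication formula merges the two half-integer-spaced Pochhammer symbols; its factor \<open>4 ^ k\<close>
  turns the denominator \<open>16\<close> of the argument into the \<open>4\<close> of \<open>(z / 2)\<^sup>2\<close>.
\<close>

lemma hyp_0F3_eq_Bessel_coeff_series:
  "hyp_0F3 (\<nu> + 1) ((\<nu> + 1) / 2) ((\<nu> + 2) / 2) (- b * z\<^sup>2 * (of_real t)\<^sup>2 / 16) =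
     (\<Sum>k. Bessel_coeff \<nu> (- b * (z / 2)\<^sup>2) k * of_real t ^ (2 * k))"
  unfolding hyp_0F3_def
proof (rule suminf_cong)
  fix k :: nat
  have half: "(\<nu> + 2) / 2 = (\<nu> + 1) / 2 + 1 / 2"
    by (simp add: field_simps)
  have dup: "pochhammer (\<nu> + 1) (2 * k) =
      4 ^ k * (pochhammer ((\<nu> + 1) / 2) k * pochhammer ((\<nu> + 2) / 2) k)"
  proof -
    have "2 * ((\<nu> + 1) / 2) = \<nu> + 1"
      by simp
    then show ?thesis
      using pochhammer_double[of "(\<nu> + 1) / 2" k]
      by (simp only: half power_mult mult.assoc of_nat_power) simp
  qed
  have "(- b * z\<^sup>2 * (of_real t)\<^sup>2 / 16) ^ k =
      (- b * (z / 2)\<^sup>2 * (of_real t)\<^sup>2 / 4) ^ k"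
    by (simp add: power_divide)
  also have "\<dots> = (- b * (z / 2)\<^sup>2) ^ k * of_real t ^ (2 * k) / 4 ^ k"
    by (simp only: power_divide[of _ 4] power_mult_distrib[of "_ * _" "(of_real t)\<^sup>2"] power_mult)
  finally have pow: "(- b * z\<^sup>2 * (of_real t)\<^sup>2 / 16) ^ k =
      (- b * (z / 2)\<^sup>2) ^ k * of_real t ^ (2 * k) / 4 ^ k" .
  show "1 / (pochhammer (\<nu> + 1) k * pochhammer ((\<nu> + 1) / 2) k *
        pochhammer ((\<nu> + 2) / 2) k) * ((- b * z\<^sup>2 * (of_real t)\<^sup>2 / 16) ^ k / fact k) =
      Bessel_coeff \<nu> (- b * (z / 2)\<^sup>2) k * of_real t ^ (2 * k)"
    unfolding Bessel_coeff_def dup pow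
    by (simp only: divide_inverse inverse_mult_distrib mult_1_left mult_ac)
qed

text \<open>
  The assumption \<open>z \<noteq> 0\<close> allows the principal power \<open>(z / 2) powr (2 * k + \<nu>)\<close> to be split, and
  \<open>Re \<nu> > -1\<close> keeps \<open>\<nu> + 1\<close> away from the poles of \<open>Gamma\<close>.
\<close>

lemma unified_Bessel_term_eq:
  assumes "Re \<nu> > -1" and "z \<noteq> 0"
  shows "unified_Bessel_term b c \<nu> \<rho> z k =
    (z / 2) powr \<nu> / ((Gamma (\<nu> + 1))\<^sup>2 * Gamma c) *
      (Bessel_coeff \<nu> (- b * (z / 2)\<^sup>2) k * ext_Gamma \<rho> (c + \<nu> + of_nat (2 * k)))"
proof -
  have notpole: "\<nu> + 1 \<notin> \<int>\<^sub>\<le>\<^sub>0"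
    using assms(1) by (auto elim!: nonpos_Ints_cases simp: complex_eq_iff)
  then have G: "Gamma (\<nu> + 1 + of_nat n) = pochhammer (\<nu> + 1) n * Gamma (\<nu> + 1)" for n
    by (simp add: pochhammer_Gamma Gamma_eq_zero_iff)
  have "(z / 2) powr (of_nat (2 * k) + \<nu>) = (z / 2) ^ (2 * k) * (z / 2) powr \<nu>"
    using assms(2) by (simp only: powr_add powr_nat) auto
  then have P: "(z / 2) powr (2 * of_nat k + \<nu>) = ((z / 2)\<^sup>2) ^ k * (z / 2) powr \<nu>"
    by (simp add: power_mult)
  have G1: "Gamma (\<nu> + of_nat k + 1) = pochhammer (\<nu> + 1) k * Gamma (\<nu> + 1)"
    using G[of k] by (simp add: algebra_simps)
  have G2: "Gamma (\<nu> + 2 * of_nat k + 1) = pochhammer (\<nu> + 1) (2 * k) * Gamma (\<nu> + 1)"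
    using G[of "2 * k"] by (simp add: algebra_simps)
  have E: "ext_Gamma \<rho> (c + (2 * of_nat k + \<nu>)) = ext_Gamma \<rho> (c + \<nu> + of_nat (2 * k))"
    by (simp add: algebra_simps)
  show ?thesis
    unfolding unified_Bessel_term_def gen_pochhammer_def Bessel_coeff_def P G1 G2 E
      power_mult_distrib[of "- b"]
    by (simp add: power2_eq_square[of "Gamma _"] mult_ac)
qed

theorem theorem2p3:
  fixes b c \<nu> \<rho> z :: complex
  assumes "Re c > 0" and "Re \<nu> > -1" and "Re \<rho> > 0" and "z \<notin> \<real>\<^sub>\<le>\<^sub>0"
  shows "summable (unified_Bessel_term b c \<nu> \<rho> z) \<and>
    set_integrable lborel {0<..} (\<lambda>t::real.
        of_real t powr (c + \<nu> - 1) * exp (- of_real t - \<rho> / of_real t) *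
        hyp_0F3 (\<nu> + 1) ((\<nu> + 1) / 2) ((\<nu> + 2) / 2) (- b * z\<^sup>2 * (of_real t)\<^sup>2 / 16)) \<and>
    unified_Bessel b c \<nu> \<rho> z =
      (z / 2) powr \<nu> / ((Gamma (\<nu> + 1))\<^sup>2 * Gamma c) *
      (LBINT t:{0<..}.
        of_real t powr (c + \<nu> - 1) * exp (- of_real t - \<rho> / of_real t) *
        hyp_0F3 (\<nu> + 1) ((\<nu> + 1) / 2) ((\<nu> + 2) / 2) (- b * z\<^sup>2 * (of_real t)\<^sup>2 / 16))"
proof -
  define A where "A = Bessel_coeff \<nu> (- b * (z / 2)\<^sup>2)"
  define I where "I = (LBINT t:{0<..}.
    ext_Gamma_kernel \<rho> (c + \<nu>) t * (\<Sum>k. A k * of_real t ^ (2 * k)))"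
  have z: "z \<noteq> 0"
    using assms(4) by auto
  have A: "summable (\<lambda>k. norm (A k) * (fact (2 * k) * 2 ^ (2 * k)))"
    unfolding A_def by (rule summable_Bessel_coeff[OF assms(2)])
  have integrand: "of_real t powr (c + \<nu> - 1) * exp (- of_real t - \<rho> / of_real t) *
        hyp_0F3 (\<nu> + 1) ((\<nu> + 1) / 2) ((\<nu> + 2) / 2) (- b * z\<^sup>2 * (of_real t)\<^sup>2 / 16) =
      ext_Gamma_kernel \<rho> (c + \<nu>) t * (\<Sum>k. A k * of_real t ^ (2 * k))" for t
    by (simp only: hyp_0F3_eq_Bessel_coeff_series A_def ext_Gamma_kernel_def)
  have "(\<lambda>k. A k * ext_Gamma \<rho> (c + \<nu> + of_nat (2 * k))) sums I"
    unfolding I_def by (rule ext_Gamma_kernel_series_sums[OF assms(3) A])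
  then have "unified_Bessel_term b c \<nu> \<rho> z sums
      ((z / 2) powr \<nu> / ((Gamma (\<nu> + 1))\<^sup>2 * Gamma c) * I)"
    unfolding unified_Bessel_term_eq[OF assms(2) z, abs_def] A_def by (rule sums_mult)
  then show ?thesis
    unfolding integrand unified_Bessel_def
    using ext_Gamma_kernel_series_integrable[OF assms(3) A, of "c + \<nu>"]
    by (simp add: sums_iff I_def)
qed

end
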